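(* Let $n\ge1$. Let $\mathsf B'(n)=(\mathsf b_{j+k+1})_{0\le j,k<n}$ be the shifted Hankel matrix of middle binomial coefficients and let $\mathsf R'(n)$ be the lower unitriangular matrix with $\mathsf B'(n)=\mathsf R'(n)\cdot\mathrm{diag}(2,2,\dots,2)\cdot\mathsf R'(n)^T$. For $0\le j,k<n$, $$\bigl(\mathsf R'(n)^{-1}\bigr)_{j,k}=(-1)^{j+k}\left[2\binom{j+k+1}{j-k}-\binom{j+k}{j-k}\right],$$ $$\bigl(\mathsf B'(n)^{-1}\bigr)_{j,k}=(-1)^{j+k}\sum_{i=\max\{j,k\}}^{n-1}\frac12\left[2\binom{i+j+1}{i-j}-\binom{i+j}{i-j}\right]\left[2\binom{i+k+1}{i-k}-\binom{i+k}{i-k}\right].$$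
   Context: $\mathsf b_p=\binom{2p}{p}$. Lower unitriangular means lower triangular with all diagonal entries equal to $1$. Concretely, the entries of $\mathsf R'(n)$ (shifted semi-binomial numbers) are $\mathsf b'_{j,k}=\mathsf b_{j,k}+\mathsf b_{j,k+1}$, where $\mathsf b_{p,q}=\sum_{\ell=q}^{p}\left[\binom{2p}{p+\ell}-\binom{2p}{p+\ell+1}\right]$ for $0\le q\le p$ and $\mathsf b_{p,q}=0$ for $q>p$. Binomial coefficients $\binom pq$ with $q<0$ are $0$. *)

theory Defs
  imports "Jordan_Normal_Form.Gauss_Jordan_Elimination"
begin

text \<open>
  Binomial coefficients with an integer lower index, equal to 0 when that index is negative.
  Truncated subtraction on \<^typ>\<open>nat\<close> would give 1 for lower index \<open>j - k\<close> with \<open>j < k\<close>.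
\<close>

definition binom :: "nat \<Rightarrow> int \<Rightarrow> rat" where
  "binom p q = (if q < 0 then 0 else of_nat (p choose nat q))"

definition middle_binomial :: "nat \<Rightarrow> rat" where
  "middle_binomial p = of_nat ((2 * p) choose p)"

definition semi_binomial :: "nat \<Rightarrow> nat \<Rightarrow> rat" where
  "semi_binomial p q =
     (if q \<le> p
      then \<Sum>l = q..p. of_nat ((2 * p) choose (p + l)) - of_nat ((2 * p) choose (p + l + 1))
      else 0)"

definition shifted_semi_binomial :: "nat \<Rightarrow> nat \<Rightarrow> rat" where
  "shifted_semi_binomial j k = semi_binomial j k + semi_binomial j (k + 1)"

definition shifted_hankel :: "nat \<Rightarrow> rat mat" where
  "shifted_hankel n = mat n n (\<lambda>(j, k). middle_binomial (j + k + 1))"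

definition shifted_semi_binomial_mat :: "nat \<Rightarrow> rat mat" where
  "shifted_semi_binomial_mat n = mat n n (\<lambda>(j, k). shifted_semi_binomial j k)"

definition lower_unitriangular :: "nat \<Rightarrow> rat mat \<Rightarrow> bool" where
  "lower_unitriangular n A \<longleftrightarrow>
     A \<in> carrier_mat n n \<and>
     (\<forall>i<n. A $$ (i, i) = 1) \<and>
     (\<forall>i<n. \<forall>j<n. i < j \<longrightarrow> A $$ (i, j) = 0)"

end

theory Submission
  imports Defs "Jordan_Normal_Form.Determinant"
begin

text \<open>
  Write \<open>R\<close> for the shifted semi-binomial matrix and \<open>S\<close> for its claimed inverse. Put
  \<open>w = x^(1/2) + x^(-1/2)\<close> and \<open>z_k = x^(k + 1/2) + x^(-k - 1/2)\<close>. The sum defining a semi-binomial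
  number telescopes, so \<open>R\<close> has the entries \<open>(2j+1) choose (j+k+1)\<close>, and the binomial theorem reads
  \<open>w^(2j+1) = \<Sum>_k R_jk z_k\<close>. Thus \<open>R\<close> is the change of basis from the \<open>z_k\<close> to the odd powers of \<open>w\<close>
  in the space of odd Laurent polynomials in \<open>x^(1/2)\<close> that are symmetric under \<open>x \<mapsto> 1/x\<close>.

  The factorization says that the \<open>z_k\<close> are orthogonal: the constant term of \<open>z_i z_k\<close> is \<open>2\<close> if
  \<open>i = k\<close> and \<open>0\<close> otherwise, whereas the constant term of \<open>w^(2j+1) w^(2k+1)\<close> is the middle binomial
  coefficient of index \<open>j+k+1\<close>. On coefficients this is the Vandermonde convolution folded at its
  middle, lemma \<open>half_vandermonde\<close>. A factor that is unitriangular is then determined column by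
  column, lemma \<open>lower_unitriangular_factor_unique\<close>.

  The inverse change of basis writes \<open>z_j\<close> as a polynomial in \<open>w\<close>, which is the Chebyshev polynomial
  \<open>2 T_(2j+1)(w/2)\<close>; its coefficients are the entries of \<open>S\<close>. To prove \<open>R S = 1\<close> without these
  polynomials, one uses that multiplication by \<open>w^2\<close> acts on the basis \<open>z\<close> by a tridiagonal matrix
  \<open>M\<close>, since \<open>w^2 z_k = z_(k-1) + 2 z_k + z_(k+1)\<close> with \<open>z_(-1) = z_0\<close>, and on the powers of \<open>w\<close> by a
  shift. So passing from a row of \<open>R\<close> to the next one is multiplication by \<open>M\<close> from the right, while
  multiplying \<open>S\<close> by \<open>M\<close> from the left shifts its columns; together they give
  \<open>(R S)_(j+1,k+1) = (R S)_(j,k)\<close>, lemma \<open>shifted_semi_binomial_odd_lucas_step\<close>, and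
  induction on \<open>j\<close> finishes the argument. Finally \<open>R (2) R\<^sup>T\<close> has the inverse
  \<open>S\<^sup>T (1/2) S\<close>, whose entries are the stated sums because \<open>S\<close> is lower triangular.
\<close>

section \<open>Shifted semi-binomial numbers\<close>

lemma semi_binomial_eq_choose: "semi_binomial p q = of_nat ((2 * p) choose (p + q))"
proof (cases "q \<le> p")
  case True
  have "(\<Sum>l = q..p. of_nat ((2 * p) choose (p + l)) - of_nat ((2 * p) choose (p + l + 1)))
      = (of_nat ((2 * p) choose (p + q)) - of_nat ((2 * p) choose (p + (p + 1))) :: rat)"
    using sum_Suc_diff[of q p "\<lambda>l. - (of_nat ((2 * p) choose (p + l)) :: rat)"] True by simp
  then show ?thesis using True by (simp add: semi_binomial_def binomial_eq_0)
next
  case False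
  then show ?thesis by (simp add: semi_binomial_def binomial_eq_0)
qed

lemma shifted_semi_binomial_eq_choose:
  "shifted_semi_binomial j k = of_nat ((2 * j + 1) choose (j + k + 1))"
  by (simp add: shifted_semi_binomial_def semi_binomial_eq_choose)

lemma shifted_semi_binomial_eq_0: "j < k \<Longrightarrow> shifted_semi_binomial j k = 0"
  by (simp add: shifted_semi_binomial_eq_choose binomial_eq_0)

lemma shifted_semi_binomial_diag: "shifted_semi_binomial j j = 1"
  by (simp add: shifted_semi_binomial_eq_choose flip: mult_2)

lemma lower_unitriangular_shifted_semi_binomial_mat:
  "lower_unitriangular n (shifted_semi_binomial_mat n)"
  by (simp add: lower_unitriangular_def shifted_semi_binomial_mat_def
      shifted_semi_binomial_eq_0 shifted_semi_binomial_diag)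

section \<open>The symmetric factorization of the Hankel matrix\<close>

text \<open>
  In the Vandermonde convolution of the odd rows \<open>2j+1\<close> and \<open>2k+1\<close> at the middle index, the
  symmetry of both rows exchanges the terms \<open>m \<le> j\<close> and the terms \<open>m > j\<close>, and there is no
  middle term left over. So the whole sum is twice either half.
\<close>

lemma half_vandermonde:
  "2 * (\<Sum>i\<le>j. ((2 * j + 1) choose (j + i + 1)) * ((2 * k + 1) choose (k + i + 1)))
     = (2 * (j + k + 1)) choose (j + k + 1)"
proof -
  define f where "f m = ((2 * j + 1) choose m) * ((2 * k + 1) choose (j + k + 1 - m))" for m
  have large: "(2 * k + 1) choose (j + k + 1 - m) = (2 * k + 1) choose (m + k - j)"
    if "j < m" "m \<le> j + k + 1" for m
    using that by (subst binomial_symmetric) (auto intro!: arg_cong2[of _ _ _ _ "(choose)"])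
  have vand: "(2 * (j + k + 1)) choose (j + k + 1) = (\<Sum>m\<le>j + k + 1. f m)"
    using vandermonde[of "2 * j + 1" "2 * k + 1" "j + k + 1"]
    by (simp add: f_def algebra_simps)
  have "(\<Sum>m\<le>j + k + 1. f m) = (\<Sum>m\<in>{..j} \<union> {j + 1..j + k + 1}. f m)"
    by (rule sum.cong) auto
  also have "\<dots> = (\<Sum>m\<le>j. f m) + (\<Sum>m = j + 1..j + k + 1. f m)"
    by (rule sum.union_disjoint) auto
  also have "(\<Sum>m\<le>j. f m) =
      (\<Sum>i\<le>j. ((2 * j + 1) choose (j + i + 1)) * ((2 * k + 1) choose (k + i + 1)))"
  proof (rule sum.reindex_bij_witness[of _ "\<lambda>i. j - i" "\<lambda>m. j - m"])
    fix m assume m: "m \<in> {..j}"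
    have "(2 * j + 1) choose m = (2 * j + 1) choose (j + (j - m) + 1)"
      using m by (subst binomial_symmetric) (auto intro!: arg_cong2[of _ _ _ _ "(choose)"])
    moreover have "k + (j - m) + 1 = j + k + 1 - m"
      using m by simp
    ultimately show "((2 * j + 1) choose (j + (j - m) + 1)) * ((2 * k + 1) choose (k + (j - m) + 1)) = f m"
      by (simp only: f_def)
  qed auto
  also have "(\<Sum>m = j + 1..j + k + 1. f m) =
      (\<Sum>i\<le>k. ((2 * j + 1) choose (j + i + 1)) * ((2 * k + 1) choose (k + i + 1)))"
  proof (rule sum.reindex_bij_witness[of _ "\<lambda>i. j + 1 + i" "\<lambda>m. m - (j + 1)"])
    fix m assume m: "m \<in> {j + 1..j + k + 1}"
    then have "j + (m - (j + 1)) + 1 = m" "k + (m - (j + 1)) + 1 = m + k - j"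
      by auto
    then show "((2 * j + 1) choose (j + (m - (j + 1)) + 1)) *
        ((2 * k + 1) choose (k + (m - (j + 1)) + 1)) = f m"
      using large[of m] m by (simp only: f_def) simp
  qed auto
  \<comment> \<open>Both sums effectively end at \<open>min j k\<close>, the remaining binomials being zero.\<close>
  also have "(\<Sum>i\<le>k. ((2 * j + 1) choose (j + i + 1)) * ((2 * k + 1) choose (k + i + 1)))
     = (\<Sum>i\<le>j. ((2 * j + 1) choose (j + i + 1)) * ((2 * k + 1) choose (k + i + 1)))"
    by (rule sum.mono_neutral_cong[where S = "{..k}"]) (auto simp: binomial_eq_0)
  finally show ?thesis using vand by simp
qed

lemma middle_binomial_eq_sum:
  assumes "j < n"
  shows "middle_binomial (j + k + 1)
    = (\<Sum>i<n. 2 * shifted_semi_binomial j i * shifted_semi_binomial k i)"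
proof -
  have "middle_binomial (j + k + 1)
      = of_nat (2 * (\<Sum>i\<le>j. ((2 * j + 1) choose (j + i + 1)) * ((2 * k + 1) choose (k + i + 1))))"
    unfolding half_vandermonde middle_binomial_def ..
  also have "\<dots> = (\<Sum>i\<le>j. 2 * shifted_semi_binomial j i * shifted_semi_binomial k i)"
    unfolding of_nat_mult of_nat_sum shifted_semi_binomial_eq_choose sum_distrib_left mult.assoc
      of_nat_numeral ..
  also have "\<dots> = (\<Sum>i<n. 2 * shifted_semi_binomial j i * shifted_semi_binomial k i)"
    using assms by (intro sum.mono_neutral_left) (auto simp: shifted_semi_binomial_eq_0)
  finally show ?thesis .
qed

lemma index_mult_diag_transpose:
  fixes A B :: "'a::comm_semiring_1 mat"
  assumes "A \<in> carrier_mat n n" "B \<in> carrier_mat n n" "j < n" "k < n"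
  shows "(A * mat_diag n (\<lambda>_. c) * transpose_mat B) $$ (j, k)
    = (\<Sum>i<n. c * A $$ (j, i) * B $$ (k, i))"
  using assms
  by (auto simp: mat_diag_mult_right scalar_prod_def ac_simps intro!: sum.cong)

lemma shifted_hankel_factorization:
  "shifted_hankel n = shifted_semi_binomial_mat n * mat_diag n (\<lambda>_. 2) *
     transpose_mat (shifted_semi_binomial_mat n)"
proof (rule eq_matI)
  have R: "shifted_semi_binomial_mat n \<in> carrier_mat n n"
    by (simp add: shifted_semi_binomial_mat_def)
  fix j k
  assume "j < dim_row (shifted_semi_binomial_mat n * mat_diag n (\<lambda>_. 2) *
      transpose_mat (shifted_semi_binomial_mat n))"
    and "k < dim_col (shifted_semi_binomial_mat n * mat_diag n (\<lambda>_. 2) *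
      transpose_mat (shifted_semi_binomial_mat n))"
  then have jk: "j < n" "k < n" using R by auto
  then show "shifted_hankel n $$ (j, k) = (shifted_semi_binomial_mat n * mat_diag n (\<lambda>_. 2) *
      transpose_mat (shifted_semi_binomial_mat n)) $$ (j, k)"
    unfolding index_mult_diag_transpose[OF R R jk]
    using middle_binomial_eq_sum[OF \<open>j < n\<close>, of k]
    by (simp add: shifted_hankel_def shifted_semi_binomial_mat_def)
qed (simp_all add: shifted_hankel_def shifted_semi_binomial_mat_def)

text \<open>
  Entry \<open>(j, k)\<close> of the product is \<open>c * A $$ (j, k)\<close>, as the diagonal of \<open>A\<close> is \<open>1\<close>, plus a sum over the
  columns of \<open>A\<close> before the \<open>k\<close>-th. Hence the product determines the columns one after another.
\<close>

lemma lower_unitriangular_factor_unique: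
  assumes A: "lower_unitriangular n A" and B: "lower_unitriangular n B" and "c \<noteq> 0"
    and eq: "A * mat_diag n (\<lambda>_. c) * transpose_mat A = B * mat_diag n (\<lambda>_. c) * transpose_mat B"
  shows "A = B"
proof -
  have carrier: "A \<in> carrier_mat n n" "B \<in> carrier_mat n n"
    using A B by (auto simp: lower_unitriangular_def)
  have column: "X \<in> carrier_mat n n \<Longrightarrow> lower_unitriangular n X \<Longrightarrow> j < n \<Longrightarrow> k < n \<Longrightarrow>
      (X * mat_diag n (\<lambda>_. c) * transpose_mat X) $$ (j, k)
        = (\<Sum>i<k. c * X $$ (j, i) * X $$ (k, i)) + c * X $$ (j, k)" for X j k
  proof -
    assume X: "X \<in> carrier_mat n n" "lower_unitriangular n X" and jk: "j < n" "k < n"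
    have "(\<Sum>i<n. c * X $$ (j, i) * X $$ (k, i)) = (\<Sum>i<Suc k. c * X $$ (j, i) * X $$ (k, i))"
      using X jk by (intro sum.mono_neutral_right) (auto simp: lower_unitriangular_def)
    then show ?thesis
      unfolding index_mult_diag_transpose[OF X(1) X(1) jk]
      using X jk by (simp add: lower_unitriangular_def)
  qed
  have "\<forall>j<n. A $$ (j, k) = B $$ (j, k)" if "k < n" for k
    using that
  proof (induction k rule: less_induct)
    case (less k)
    show ?case
    proof (intro allI impI)
      fix j assume "j < n"
      have "(\<Sum>i<k. c * A $$ (j, i) * A $$ (k, i)) = (\<Sum>i<k. c * B $$ (j, i) * B $$ (k, i))"
        using less \<open>j < n\<close> by (intro sum.cong) auto
      then show "A $$ (j, k) = B $$ (j, k)"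
        using column[OF carrier(1) A \<open>j < n\<close> less.prems] column[OF carrier(2) B \<open>j < n\<close> less.prems]
          eq \<open>c \<noteq> 0\<close> by simp
    qed
  qed
  then show ?thesis using carrier by (intro eq_matI) auto
qed

section \<open>The inverse of the shifted semi-binomial matrix\<close>

text \<open>
  The coefficient of \<open>w^(2k+1)\<close> in \<open>2 T_(2j+1)(w/2)\<close>, an odd Vieta-Lucas polynomial. With lower index
  \<open>2k+1\<close> in both binomials, the case \<open>j < k\<close> needs no special treatment, and the recurrence in
  \<open>j\<close> is a second difference given by Pascal's rule.
\<close>

definition odd_lucas_coeff :: "nat \<Rightarrow> nat \<Rightarrow> rat" where
  "odd_lucas_coeff j k
     = (-1) ^ (j + k) * of_nat (((j + k + 1) choose (2 * k + 1)) + ((j + k) choose (2 * k + 1)))"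

definition odd_lucas_mat :: "nat \<Rightarrow> rat mat" where
  "odd_lucas_mat n = mat n n (\<lambda>(j, k). odd_lucas_coeff j k)"

lemma odd_lucas_coeff_eq_0: "j < k \<Longrightarrow> odd_lucas_coeff j k = 0"
  by (simp add: odd_lucas_coeff_def binomial_eq_0)

lemma odd_lucas_coeff_eq_binom:
  "odd_lucas_coeff j k = (-1) ^ (j + k) *
     (2 * binom (j + k + 1) (int j - int k) - binom (j + k) (int j - int k))"
proof (cases "k \<le> j")
  case True
  then have "nat (int j - int k) = j - k" by simp
  moreover have "(j + k + 1) choose (j - k) = (j + k + 1) choose (2 * k + 1)"
    using True by (subst binomial_symmetric) (auto intro!: arg_cong2[of _ _ _ _ "(choose)"])
  moreover have "(j + k) choose (j - k) = (j + k) choose (2 * k)"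
    using True by (subst binomial_symmetric) (auto intro!: arg_cong2[of _ _ _ _ "(choose)"])
  ultimately show ?thesis
    using True by (simp add: odd_lucas_coeff_def binom_def)
next
  case False
  then show ?thesis by (simp add: odd_lucas_coeff_eq_0 binom_def)
qed

text \<open>
  In terms of polynomials: \<open>z_(i+2) + 2 z_(i+1) + z_i = w^2 z_(i+1)\<close>, where multiplication by \<open>w^2\<close>
  moves the coefficients up by one index \<open>k\<close>.
\<close>

lemma odd_lucas_coeff_rec:
  "odd_lucas_coeff (Suc (Suc i)) k + 2 * odd_lucas_coeff (Suc i) k + odd_lucas_coeff i k
     = (if k = 0 then 0 else odd_lucas_coeff (Suc i) (k - 1))"
  by (cases k) (simp_all add: odd_lucas_coeff_def algebra_simps)

text \<open>At the lower end \<open>z_(-1) = z_0\<close> turns the coefficient \<open>2\<close> into \<open>3\<close>.\<close>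

lemma odd_lucas_coeff_rec_0:
  "odd_lucas_coeff 1 k + 3 * odd_lucas_coeff 0 k = (if k = 0 then 0 else odd_lucas_coeff 0 (k - 1))"
proof -
  consider "k = 0" | "k = 1" | "k > 1" by linarith
  then show ?thesis
    by cases (simp_all add: odd_lucas_coeff_def binomial_eq_0 eval_nat_numeral)
qed

text \<open>
  Here too the missing neighbour to the left equals the entry at \<open>0\<close>, because the two middle
  binomials of an odd row agree.
\<close>

lemma shifted_semi_binomial_rec_0:
  "shifted_semi_binomial (Suc j) 0 = 3 * shifted_semi_binomial j 0 + shifted_semi_binomial j 1"
proof -
  have "(2 * j + 1) choose j = (2 * j + 1) choose (j + 1)"
    by (subst binomial_symmetric) (auto intro!: arg_cong2[of _ _ _ _ "(choose)"])
  then show ?thesis by (simp add: shifted_semi_binomial_eq_choose)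
qed

lemma shifted_semi_binomial_rec:
  "shifted_semi_binomial (Suc j) (Suc i) = shifted_semi_binomial j i
     + 2 * shifted_semi_binomial j (Suc i) + shifted_semi_binomial j (Suc (Suc i))"
  by (simp add: shifted_semi_binomial_eq_choose)

text \<open>
  Associativity \<open>(a M) b = a (M b)\<close> for a row \<open>a\<close>, a column \<open>b\<close> and the tridiagonal matrix \<open>M\<close>
  of multiplication by \<open>w^2\<close>. The assumptions make the terms vanish that the truncation would
  leave behind at the upper end.
\<close>

lemma sum_tridiagonal_transfer:
  fixes a b :: "nat \<Rightarrow> 'a::comm_ring_1"
  assumes "a (Suc m) = 0" "a (Suc (Suc m)) = 0"
  shows "(3 * a 0 + a 1) * b 0
      + (\<Sum>i\<le>m. (a i + 2 * a (Suc i) + a (Suc (Suc i))) * b (Suc i))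
    = a 0 * (b 1 + 3 * b 0) + (\<Sum>i<m. a (Suc i) * (b (Suc (Suc i)) + 2 * b (Suc i) + b i))"
proof -
  have general: "(3 * a 0 + a 1) * b 0
      + (\<Sum>i\<le>m. (a i + 2 * a (Suc i) + a (Suc (Suc i))) * b (Suc i))
    = a 0 * (b 1 + 3 * b 0) + (\<Sum>i<m. a (Suc i) * (b (Suc (Suc i)) + 2 * b (Suc i) + b i))
      + a (Suc m) * (2 * b (Suc m) + b m) + a (Suc (Suc m)) * b (Suc m)" for m
    by (induction m) (simp_all add: algebra_simps)
  show ?thesis using general[of m] assms by simp
qed

text \<open>
  The two recurrences combined: a step down in \<open>R\<close> is absorbed as a column shift of \<open>S\<close>.
  The ranges differ by one because the degree of \<open>w^(2j+1)\<close> grows with \<open>j\<close>.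
\<close>

lemma shifted_semi_binomial_odd_lucas_step:
  assumes "j < Suc m"
  shows "(\<Sum>i<Suc (Suc m). shifted_semi_binomial (Suc j) i * odd_lucas_coeff i k)
    = (if k = 0 then 0
       else (\<Sum>i<Suc m. shifted_semi_binomial j i * odd_lucas_coeff i (k - 1)))"
proof -
  let ?R = "shifted_semi_binomial" and ?S = "odd_lucas_coeff"
  have "(\<Sum>i<Suc (Suc m). ?R (Suc j) i * ?S i k)
      = (3 * ?R j 0 + ?R j 1) * ?S 0 k
        + (\<Sum>i\<le>m. (?R j i + 2 * ?R j (Suc i) + ?R j (Suc (Suc i))) * ?S (Suc i) k)"
    unfolding sum.lessThan_Suc_shift[of _ "Suc m"]
    unfolding shifted_semi_binomial_rec shifted_semi_binomial_rec_0 lessThan_Suc_atMost ..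
  also have "\<dots> = ?R j 0 * (?S 1 k + 3 * ?S 0 k)
      + (\<Sum>i<m. ?R j (Suc i) * (?S (Suc (Suc i)) k + 2 * ?S (Suc i) k + ?S i k))"
    using assms by (intro sum_tridiagonal_transfer) (auto simp: shifted_semi_binomial_eq_0)
  also have "\<dots> = (if k = 0 then 0 else (\<Sum>i<Suc m. ?R j i * ?S i (k - 1)))"
    unfolding odd_lucas_coeff_rec odd_lucas_coeff_rec_0 sum.lessThan_Suc_shift by simp
  finally show ?thesis .
qed

lemma shifted_semi_binomial_odd_lucas_orthogonal:
  assumes "j < n"
  shows "(\<Sum>i<n. shifted_semi_binomial j i * odd_lucas_coeff i k) = (if j = k then 1 else 0)"
  using assms
proof (induction j arbitrary: k n)
  case 0
  then obtain m where n: "n = Suc m" by (cases n) auto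
  have "odd_lucas_coeff 0 k = (if k = 0 then 1 else 0)"
    by (cases "k = 0") (simp_all add: odd_lucas_coeff_eq_0, simp add: odd_lucas_coeff_def)
  then show ?case
    unfolding n sum.lessThan_Suc_shift
    by (auto simp: shifted_semi_binomial_diag shifted_semi_binomial_eq_0)
next
  case (Suc j)
  from Suc.prems obtain m where n: "n = Suc (Suc m)"
    using less_imp_Suc_add[of "Suc j" n] by auto
  with Suc.prems have j: "j < Suc m" by simp
  show ?case
  proof (cases k)
    case 0
    then show ?thesis
      unfolding n shifted_semi_binomial_odd_lucas_step[OF j] by simp
  next
    case (Suc k')
    then show ?thesis
      unfolding n shifted_semi_binomial_odd_lucas_step[OF j]
      using Suc.IH[OF j, of k'] by (simp del: sum.lessThan_Suc)
  qed
qed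

lemma shifted_semi_binomial_mat_mult_odd_lucas_mat:
  "shifted_semi_binomial_mat n * odd_lucas_mat n = 1\<^sub>m n"
  by (rule eq_matI)
    (simp_all add: shifted_semi_binomial_mat_def odd_lucas_mat_def scalar_prod_def
      shifted_semi_binomial_odd_lucas_orthogonal flip: lessThan_atLeast0)

section \<open>Inverses of the matrices\<close>

text \<open>
  Over a field a one-sided inverse of a square matrix is two-sided, so Gauss-Jordan elimination
  cannot fail, and its result is \<open>B\<close> because inverses are unique.
\<close>

lemma mat_inverse_eq_SomeI:
  fixes A B :: "'a::field mat"
  assumes A: "A \<in> carrier_mat n n" and B: "B \<in> carrier_mat n n" and AB: "A * B = 1\<^sub>m n"
  shows "mat_inverse A = Some B"
proof -
  have BA: "B * A = 1\<^sub>m n" by (rule mat_mult_left_right_inverse[OF A B AB])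
  show ?thesis
  proof (cases "mat_inverse A")
    case None
    have "A \<in> Units (ring_mat TYPE('a) n ())"
      using A B AB BA by (auto simp: Units_def ring_mat_def)
    with mat_inverse(1)[OF A None, of "()"] show ?thesis by blast
  next
    case (Some C)
    then have C: "A * C = 1\<^sub>m n" "C \<in> carrier_mat n n"
      using mat_inverse(2)[OF A] by auto
    have "B = B * (A * C)" using B C by simp
    also have "\<dots> = (B * A) * C" using A B C by (simp add: assoc_mult_mat[of _ n n _ n _ n])
    also have "\<dots> = C" using BA C by simp
    finally show ?thesis using Some by simp
  qed
qed

lemma mat_inverse_mult_diag_transpose:
  fixes A B :: "'a::field mat"
  assumes A: "A \<in> carrier_mat n n" and B: "B \<in> carrier_mat n n" and AB: "A * B = 1\<^sub>m n"
    and "c \<noteq> 0"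
  shows "mat_inverse (A * mat_diag n (\<lambda>_. c) * transpose_mat A)
    = Some (transpose_mat B * mat_diag n (\<lambda>_. 1 / c) * B)"
proof (rule mat_inverse_eq_SomeI[of _ n])
  have BA: "B * A = 1\<^sub>m n" by (rule mat_mult_left_right_inverse[OF A B AB])
  have T: "transpose_mat A * transpose_mat B = 1\<^sub>m n"
    using transpose_mult[OF B A] BA by simp
  have diag: "mat_diag n (\<lambda>_. c) * mat_diag n (\<lambda>_. 1 / c) = 1\<^sub>m n"
    using \<open>c \<noteq> 0\<close> by simp
  let ?D = "mat_diag n (\<lambda>_. c)" and ?E = "mat_diag n (\<lambda>_. 1 / c)"
  have DE: "?D \<in> carrier_mat n n" "?E \<in> carrier_mat n n" by auto
  have tr: "transpose_mat A \<in> carrier_mat n n" "transpose_mat B \<in> carrier_mat n n"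
    using A B by auto
  have "(A * ?D * transpose_mat A) * (transpose_mat B * ?E * B)
      = A * (?D * ((transpose_mat A * transpose_mat B) * (?E * B)))"
    using A B DE tr by (simp add: mult_carrier_mat[of _ n n _ n] assoc_mult_mat[of _ n n _ n _ n] del: mat_diag_diag)
  also have "\<dots> = A * ((?D * ?E) * B)"
    using A B DE by (simp add: T mult_carrier_mat[of _ n n _ n] left_mult_one_mat[of _ n n] assoc_mult_mat[of _ n n _ n _ n] del: mat_diag_diag)
  also have "\<dots> = 1\<^sub>m n"
    unfolding diag using AB B by simp
  finally show "(A * ?D * transpose_mat A) * (transpose_mat B * ?E * B) = 1\<^sub>m n" .
qed (use A B in auto)

lemma mat_inverse_shifted_hankel:
  "mat_inverse (shifted_hankel n) = Some (mat n n (\<lambda>(j, k).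
     \<Sum>i = max j k..n - 1. 1 / 2 * odd_lucas_coeff i j * odd_lucas_coeff i k))"
proof -
  let ?S = "odd_lucas_mat n" and ?R = "shifted_semi_binomial_mat n"
  have S: "?S \<in> carrier_mat n n" and R: "?R \<in> carrier_mat n n"
    by (auto simp: odd_lucas_mat_def shifted_semi_binomial_mat_def)
  have "transpose_mat ?S * mat_diag n (\<lambda>_. 1 / 2) * ?S = mat n n (\<lambda>(j, k).
     \<Sum>i = max j k..n - 1. 1 / 2 * odd_lucas_coeff i j * odd_lucas_coeff i k)" (is "?L = ?M")
  proof (rule eq_matI)
    fix j k assume "j < dim_row ?M" "k < dim_col ?M"
    then have jk: "j < n" "k < n" by auto
    have "?L $$ (j, k) = (\<Sum>i<n. 1 / 2 * odd_lucas_coeff i j * odd_lucas_coeff i k)"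
      using index_mult_diag_transpose[of "transpose_mat ?S" n "transpose_mat ?S" j k "1 / 2"] S jk
      by (simp add: odd_lucas_mat_def)
    also have "\<dots> = (\<Sum>i = max j k..n - 1. 1 / 2 * odd_lucas_coeff i j * odd_lucas_coeff i k)"
      using jk by (intro sum.mono_neutral_right) (auto simp: odd_lucas_coeff_eq_0 not_le)
    finally show "?L $$ (j, k) = ?M $$ (j, k)" using jk by simp
  qed (use S in auto)
  then show ?thesis
    unfolding shifted_hankel_factorization
    using mat_inverse_mult_diag_transpose[OF R S shifted_semi_binomial_mat_mult_odd_lucas_mat, of 2]
    by simp
qed

theorem corollary7p7:
  fixes n :: nat
  assumes "n \<ge> 1"
  shows "lower_unitriangular n (shifted_semi_binomial_mat n) \<and>
    shifted_hankel n = shifted_semi_binomial_mat n * mat_diag n (\<lambda>_. 2) *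
      transpose_mat (shifted_semi_binomial_mat n) \<and>
    (\<forall>R. lower_unitriangular n R \<and> shifted_hankel n = R * mat_diag n (\<lambda>_. 2) * transpose_mat R
       \<longrightarrow> R = shifted_semi_binomial_mat n) \<and>
    mat_inverse (shifted_semi_binomial_mat n) = Some (mat n n (\<lambda>(j, k).
      (-1) ^ (j + k) *
        (2 * binom (j + k + 1) (int j - int k) - binom (j + k) (int j - int k)))) \<and>
    mat_inverse (shifted_hankel n) = Some (mat n n (\<lambda>(j, k).
      (-1) ^ (j + k) *
        (\<Sum>i = max j k..n - 1. 1 / 2 *
          (2 * binom (i + j + 1) (int i - int j) - binom (i + j) (int i - int j)) *
          (2 * binom (i + k + 1) (int i - int k) - binom (i + k) (int i - int k)))))"
proof (intro conjI allI impI)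
  show "lower_unitriangular n (shifted_semi_binomial_mat n)"
    by (rule lower_unitriangular_shifted_semi_binomial_mat)
  show "shifted_hankel n = shifted_semi_binomial_mat n * mat_diag n (\<lambda>_. 2) *
      transpose_mat (shifted_semi_binomial_mat n)"
    by (rule shifted_hankel_factorization)
next
  fix R
  assume R: "lower_unitriangular n R \<and>
    shifted_hankel n = R * mat_diag n (\<lambda>_. 2) * transpose_mat R"
  show "R = shifted_semi_binomial_mat n"
  proof (rule lower_unitriangular_factor_unique)
    show "R * mat_diag n (\<lambda>_. 2) * transpose_mat R = shifted_semi_binomial_mat n *
        mat_diag n (\<lambda>_. 2) * transpose_mat (shifted_semi_binomial_mat n)"
      using R shifted_hankel_factorization[of n] by (elim conjE) (rule trans[OF sym])
  qed (use R[THEN conjunct1] lower_unitriangular_shifted_semi_binomial_mat in simp_all)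
next
  show "mat_inverse (shifted_semi_binomial_mat n) = Some (mat n n (\<lambda>(j, k).
      (-1) ^ (j + k) *
        (2 * binom (j + k + 1) (int j - int k) - binom (j + k) (int j - int k))))"
    unfolding odd_lucas_coeff_eq_binom[symmetric] odd_lucas_mat_def[symmetric]
    by (rule mat_inverse_eq_SomeI[of _ n])
      (simp_all add: shifted_semi_binomial_mat_mult_odd_lucas_mat,
       simp_all add: shifted_semi_binomial_mat_def odd_lucas_mat_def)
  have sign: "1 / 2 * ((-1) ^ (i + j) * x) * ((-1) ^ (i + k) * y) = (-1) ^ (j + k) * (1 / 2 * x * y)"
    for i j k :: nat and x y :: rat
    by (simp add: power_add)
  show "mat_inverse (shifted_hankel n) = Some (mat n n (\<lambda>(j, k).
      (-1) ^ (j + k) *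
        (\<Sum>i = max j k..n - 1. 1 / 2 *
          (2 * binom (i + j + 1) (int i - int j) - binom (i + j) (int i - int j)) *
          (2 * binom (i + k + 1) (int i - int k) - binom (i + k) (int i - int k)))))"
    unfolding mat_inverse_shifted_hankel odd_lucas_coeff_eq_binom sign sum_distrib_left ..
qed

end
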